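(* Let $n,k\in\mathbb{Z}_+$, $0<\omega_l<\omega_h$, and for $\kappa\in\{1,2,3,4\}$ and $\alpha\in(0,1)$ let $\hat{\mathscr I}_\kappa^\alpha(s)$ be the piecewise rational approximate model of the fractional integrator $1/s^\alpha$ with the $\kappa$-th parameter set given in the context, and let $\hat{\mathscr D}_\kappa^\alpha(s)=1/\hat{\mathscr I}_\kappa^\alpha(s)$. Then for every $\kappa\in\{1,2,3,4\}$ and every $\alpha\in(0,0.5)\cup(0.5,1)$ (for $\kappa=3,4$, with the same admissible value of $\varepsilon$ used for the orders $\alpha$ and $1-\alpha$), the following identities of rational functions of $s$ hold: (i) $\hat{\mathscr I}_\kappa^{\alpha}(s)\,\hat{\mathscr I}_\kappa^{1-\alpha}(s)=\dfrac1s$; (ii) $\hat{\mathscr D}_\kappa^{\alpha}(s)\,\hat{\mathscr I}_\kappa^{\alpha}(s)=1$; (iii) $\hat{\mathscr D}_\kappa^{\alpha}(s)\,\hat{\mathscr D}_\kappa^{1-\alpha}(s)=s$.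
   Context: Notation: $\mathrm j=\sqrt{-1}$, $\lg=\log_{10}$, $\omega_m=\sqrt{\omega_l\omega_h}$, $r=\omega_h/\omega_l$, $\nu=0.5-|\alpha-0.5|=\min(\alpha,1-\alpha)$. Model: for each $\kappa\in\{1,2,3,4\}$, $$\hat{\mathscr I}_\kappa^{\alpha}(s)=K\prod_{i=1}^n\Big(\frac{s+z_i}{s+p_i}\Big)^k\ \text{ if } 0<\alpha\le 0.5,\qquad \hat{\mathscr I}_\kappa^{\alpha}(s)=\frac{\bar K}{s}\prod_{i=1}^n\Big(\frac{s+\bar z_i}{s+\bar p_i}\Big)^k\ \text{ if } 0.5<\alpha<1,$$ with, in all four cases, $$K=|\mathrm j\omega_m|^{-\alpha}\prod_{i=1}^n\Big|\frac{\mathrm j\omega_m+p_i}{\mathrm j\omega_m+z_i}\Big|^k,\qquad \bar K=|\mathrm j\omega_m|^{1-\alpha}\prod_{i=1}^n\Big|\frac{\mathrm j\omega_m+\bar p_i}{\mathrm j\omega_m+\bar z_i}\Big|^k.$$ The parameters $p_i,z_i,\bar p_i,\bar z_i$ ($i=1,\dots,n$) depend on $\alpha$ and $\kappa$ as follows. $\kappa=1$: $p_i=\omega_l r^{\frac{2i-1-\alpha/k}{2n}}$, $z_i=\omega_l r^{\frac{2i-1+\alpha/k}{2n}}$, $\bar p_i=\omega_l r^{\frac{2i-1+1/k-\alpha/k}{2n}}$, $\bar z_i=\omega_l r^{\frac{2i-1-1/k+\alpha/k}{2n}}$. $\kappa=2$: $p_i=\omega_l r^{\frac{i-1}{n-1+\alpha/k}}$,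 $z_i=\omega_l r^{\frac{i-1+\alpha/k}{n-1+\alpha/k}}$, $\bar p_i=\omega_l r^{\frac{i-1+1/k-\alpha/k}{n-1+1/k-\alpha/k}}$, $\bar z_i=\omega_l r^{\frac{i-1}{n-1+1/k-\alpha/k}}$. $\kappa=3$: $p_i=10^{\frac{\varepsilon(2ki-k-\alpha)}{20\alpha(k-\alpha)}}\omega_l$, $z_i=10^{\frac{\varepsilon(2ki-k+\alpha)}{20\alpha(k-\alpha)}}\omega_l$, $\bar p_i=10^{\frac{\varepsilon(2ki-k+1-\alpha)}{20(1-\alpha)(k-1+\alpha)}}\omega_l$, $\bar z_i=10^{\frac{\varepsilon(2ki-k-1+\alpha)}{20(1-\alpha)(k-1+\alpha)}}\omega_l$, where $\varepsilon$ is a real number with $\frac{20\nu(k-\nu)}{2kn+k+\nu}\lg r<\varepsilon\le\frac{20\nu(k-\nu)}{2kn-k+\nu}\lg r$. $\kappa=4$: $p_i=10^{\frac{\varepsilon(ki-k)}{10\alpha(k-\alpha)}}\omega_l$, $z_i=10^{\frac{\varepsilon(ki-k+\alpha)}{10\alpha(k-\alpha)}}\omega_l$, $\bar p_i=10^{\frac{\varepsilon(ki-k+1-\alpha)}{10(1-\alpha)(k-1+\alpha)}}\omega_l$, $\bar z_i=10^{\frac{\varepsilon(ki-k)}{10(1-\alpha)(k-1+\alpha)}}\omega_l$, where $\varepsilon$ is a real number with $\frac{10\nu(k-\nu)}{kn+\nu}\lg r<\varepsilon\le\frac{10\nu(k-\nu)}{kn-k+\nu}\lg r$. The admissible range of $\varepsilon$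 depends on $\alpha$ only through $\nu$, hence is the same for $\alpha$ and $1-\alpha$. *)

theory Defs
  imports
    "HOL-Analysis.Analysis"
    "HOL-Computational_Algebra.Computational_Algebra"
begin

(* Transfer functions are elements of the field C(s), modelled as complex poly fract,
   so that equations between them are identities of rational functions. *)

definition rf_var :: "complex poly fract" where
  "rf_var = to_fract [:0, 1:]"

definition rf_const :: "real \<Rightarrow> complex poly fract" where
  "rf_const c = to_fract [:complex_of_real c:]"

(* Arguments of the parameter functions: kappa, n, k, omega_l, omega_h, epsilon, alpha, i.
   epsilon is only used for kappa = 3 and kappa = 4. Values of kappa outside {1,2,3,4}
   are not meaningful. *)

definition p_par :: "nat \<Rightarrow> nat \<Rightarrow> nat \<Rightarrow> real \<Rightarrow> real \<Rightarrow> real \<Rightarrow> real \<Rightarrow> nat \<Rightarrow> real" where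
  "p_par \<kappa> n k \<omega>l \<omega>h \<epsilon> \<alpha> i =
    (if \<kappa> = 1 then \<omega>l * (\<omega>h / \<omega>l) powr ((2 * real i - 1 - \<alpha> / real k) / (2 * real n))
     else if \<kappa> = 2 then \<omega>l * (\<omega>h / \<omega>l) powr ((real i - 1) / (real n - 1 + \<alpha> / real k))
     else if \<kappa> = 3 then
       10 powr (\<epsilon> * (2 * real k * real i - real k - \<alpha>) / (20 * \<alpha> * (real k - \<alpha>))) * \<omega>l
     else
       10 powr (\<epsilon> * (real k * real i - real k) / (10 * \<alpha> * (real k - \<alpha>))) * \<omega>l)"

definition z_par :: "nat \<Rightarrow> nat \<Rightarrow> nat \<Rightarrow> real \<Rightarrow> real \<Rightarrow> real \<Rightarrow> real \<Rightarrow> nat \<Rightarrow> real" where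
  "z_par \<kappa> n k \<omega>l \<omega>h \<epsilon> \<alpha> i =
    (if \<kappa> = 1 then \<omega>l * (\<omega>h / \<omega>l) powr ((2 * real i - 1 + \<alpha> / real k) / (2 * real n))
     else if \<kappa> = 2 then
       \<omega>l * (\<omega>h / \<omega>l) powr ((real i - 1 + \<alpha> / real k) / (real n - 1 + \<alpha> / real k))
     else if \<kappa> = 3 then
       10 powr (\<epsilon> * (2 * real k * real i - real k + \<alpha>) / (20 * \<alpha> * (real k - \<alpha>))) * \<omega>l
     else
       10 powr (\<epsilon> * (real k * real i - real k + \<alpha>) / (10 * \<alpha> * (real k - \<alpha>))) * \<omega>l)"

definition pbar_par :: "nat \<Rightarrow> nat \<Rightarrow> nat \<Rightarrow> real \<Rightarrow> real \<Rightarrow> real \<Rightarrow> real \<Rightarrow> nat \<Rightarrow> real" where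
  "pbar_par \<kappa> n k \<omega>l \<omega>h \<epsilon> \<alpha> i =
    (if \<kappa> = 1 then
       \<omega>l * (\<omega>h / \<omega>l) powr ((2 * real i - 1 + 1 / real k - \<alpha> / real k) / (2 * real n))
     else if \<kappa> = 2 then
       \<omega>l * (\<omega>h / \<omega>l) powr
         ((real i - 1 + 1 / real k - \<alpha> / real k) / (real n - 1 + 1 / real k - \<alpha> / real k))
     else if \<kappa> = 3 then
       10 powr (\<epsilon> * (2 * real k * real i - real k + 1 - \<alpha>) /
                 (20 * (1 - \<alpha>) * (real k - 1 + \<alpha>))) * \<omega>l
     else
       10 powr (\<epsilon> * (real k * real i - real k + 1 - \<alpha>) /
                 (10 * (1 - \<alpha>) * (real k - 1 + \<alpha>))) * \<omega>l)"

definition zbar_par :: "nat \<Rightarrow> nat \<Rightarrow> nat \<Rightarrow> real \<Rightarrow> real \<Rightarrow> real \<Rightarrow> real \<Rightarrow> nat \<Rightarrow> real" where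
  "zbar_par \<kappa> n k \<omega>l \<omega>h \<epsilon> \<alpha> i =
    (if \<kappa> = 1 then
       \<omega>l * (\<omega>h / \<omega>l) powr ((2 * real i - 1 - 1 / real k + \<alpha> / real k) / (2 * real n))
     else if \<kappa> = 2 then
       \<omega>l * (\<omega>h / \<omega>l) powr ((real i - 1) / (real n - 1 + 1 / real k - \<alpha> / real k))
     else if \<kappa> = 3 then
       10 powr (\<epsilon> * (2 * real k * real i - real k - 1 + \<alpha>) /
                 (20 * (1 - \<alpha>) * (real k - 1 + \<alpha>))) * \<omega>l
     else
       10 powr (\<epsilon> * (real k * real i - real k) /
                 (10 * (1 - \<alpha>) * (real k - 1 + \<alpha>))) * \<omega>l)"

definition nu :: "real \<Rightarrow> real" where
  "nu \<alpha> = 1/2 - \<bar>\<alpha> - 1/2\<bar>"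

definition eps_admissible :: "nat \<Rightarrow> nat \<Rightarrow> nat \<Rightarrow> real \<Rightarrow> real \<Rightarrow> real \<Rightarrow> real \<Rightarrow> bool" where
  "eps_admissible \<kappa> n k \<omega>l \<omega>h \<alpha> \<epsilon> \<longleftrightarrow>
    (\<kappa> = 3 \<longrightarrow>
       20 * nu \<alpha> * (real k - nu \<alpha>) / (2 * real k * real n + real k + nu \<alpha>) * log 10 (\<omega>h / \<omega>l) < \<epsilon> \<and>
       \<epsilon> \<le> 20 * nu \<alpha> * (real k - nu \<alpha>) / (2 * real k * real n - real k + nu \<alpha>) * log 10 (\<omega>h / \<omega>l)) \<and>
    (\<kappa> = 4 \<longrightarrow>
       10 * nu \<alpha> * (real k - nu \<alpha>) / (real k * real n + nu \<alpha>) * log 10 (\<omega>h / \<omega>l) < \<epsilon> \<and>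
       \<epsilon> \<le> 10 * nu \<alpha> * (real k - nu \<alpha>) / (real k * real n - real k + nu \<alpha>) * log 10 (\<omega>h / \<omega>l))"

definition jw :: "real \<Rightarrow> real \<Rightarrow> complex" where
  "jw \<omega>l \<omega>h = \<i> * complex_of_real (sqrt (\<omega>l * \<omega>h))"

definition gain :: "nat \<Rightarrow> nat \<Rightarrow> nat \<Rightarrow> real \<Rightarrow> real \<Rightarrow> real \<Rightarrow> real \<Rightarrow> real" where
  "gain \<kappa> n k \<omega>l \<omega>h \<epsilon> \<alpha> =
    cmod (jw \<omega>l \<omega>h) powr (- \<alpha>) *
    (\<Prod>i = 1..n. cmod ((jw \<omega>l \<omega>h + of_real (p_par \<kappa> n k \<omega>l \<omega>h \<epsilon> \<alpha> i)) /
                       (jw \<omega>l \<omega>h + of_real (z_par \<kappa> n k \<omega>l \<omega>h \<epsilon> \<alpha> i))) ^ k)"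

definition gain_bar :: "nat \<Rightarrow> nat \<Rightarrow> nat \<Rightarrow> real \<Rightarrow> real \<Rightarrow> real \<Rightarrow> real \<Rightarrow> real" where
  "gain_bar \<kappa> n k \<omega>l \<omega>h \<epsilon> \<alpha> =
    cmod (jw \<omega>l \<omega>h) powr (1 - \<alpha>) *
    (\<Prod>i = 1..n. cmod ((jw \<omega>l \<omega>h + of_real (pbar_par \<kappa> n k \<omega>l \<omega>h \<epsilon> \<alpha> i)) /
                       (jw \<omega>l \<omega>h + of_real (zbar_par \<kappa> n k \<omega>l \<omega>h \<epsilon> \<alpha> i))) ^ k)"

definition frac_int :: "nat \<Rightarrow> nat \<Rightarrow> nat \<Rightarrow> real \<Rightarrow> real \<Rightarrow> real \<Rightarrow> real \<Rightarrow> complex poly fract" where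
  "frac_int \<kappa> n k \<omega>l \<omega>h \<epsilon> \<alpha> =
    (if \<alpha> \<le> 1/2 then
       rf_const (gain \<kappa> n k \<omega>l \<omega>h \<epsilon> \<alpha>) *
       (\<Prod>i = 1..n. ((rf_var + rf_const (z_par \<kappa> n k \<omega>l \<omega>h \<epsilon> \<alpha> i)) /
                     (rf_var + rf_const (p_par \<kappa> n k \<omega>l \<omega>h \<epsilon> \<alpha> i))) ^ k)
     else
       rf_const (gain_bar \<kappa> n k \<omega>l \<omega>h \<epsilon> \<alpha>) / rf_var *
       (\<Prod>i = 1..n. ((rf_var + rf_const (zbar_par \<kappa> n k \<omega>l \<omega>h \<epsilon> \<alpha> i)) /
                     (rf_var + rf_const (pbar_par \<kappa> n k \<omega>l \<omega>h \<epsilon> \<alpha> i))) ^ k))"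

definition frac_diff :: "nat \<Rightarrow> nat \<Rightarrow> nat \<Rightarrow> real \<Rightarrow> real \<Rightarrow> real \<Rightarrow> real \<Rightarrow> complex poly fract" where
  "frac_diff \<kappa> n k \<omega>l \<omega>h \<epsilon> \<alpha> = 1 / frac_int \<kappa> n k \<omega>l \<omega>h \<epsilon> \<alpha>"

end

theory Submission
  imports Defs
begin

text \<open>
  In all four parameter sets the corner frequencies of the branch for orders above \<open>1/2\<close>
  are those of the branch for orders below \<open>1/2\<close>, taken at the complementary order and with
  the roles of poles and zeros exchanged. Hence, for complementary orders, the two products of
  first-order factors are inverse to each other, and only the integrator \<open>1/s\<close> of the
  upper branch survives. The same exchange inverts the gains
  (\<open>gain_mult_gain_bar\<close>): both normalise the modulus at the same
  frequency, and the powers of that frequency have opposite exponents.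
  This is identity (i) (\<open>frac_int_mult_complement\<close>). Since the right-hand side of (i) is not
  zero, neither integrator is zero, which gives (ii); and (iii) is the reciprocal of (i).
\<close>

text \<open>In every parameter set the exponents of the upper branch depend on \<open>\<alpha>\<close>
  through \<open>1 - \<alpha>\<close> alone.\<close>

lemma pbar_par_complement:
  "pbar_par \<kappa> n k \<omega>l \<omega>h \<epsilon> (1 - \<alpha>) = z_par \<kappa> n k \<omega>l \<omega>h \<epsilon> \<alpha>"
  by (rule ext) (simp add: pbar_par_def z_par_def diff_divide_distrib add_divide_distrib algebra_simps)

lemma zbar_par_complement:
  "zbar_par \<kappa> n k \<omega>l \<omega>h \<epsilon> (1 - \<alpha>) = p_par \<kappa> n k \<omega>l \<omega>h \<epsilon> \<alpha>"
  by (rule ext) (simp add: zbar_par_def p_par_def diff_divide_distrib add_divide_distrib algebra_simps)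

lemma prod_power_quotient_inverse:
  fixes f g :: "'i \<Rightarrow> 'a :: field"
  assumes "\<And>i. i \<in> A \<Longrightarrow> f i \<noteq> 0" and "\<And>i. i \<in> A \<Longrightarrow> g i \<noteq> 0"
  shows "(\<Prod>i\<in>A. (f i / g i) ^ k) * (\<Prod>i\<in>A. (g i / f i) ^ k) = 1"
proof -
  have "(\<Prod>i\<in>A. (f i / g i) ^ k) * (\<Prod>i\<in>A. (g i / f i) ^ k)
      = (\<Prod>i\<in>A. (f i / g i * (g i / f i)) ^ k)"
    by (simp only: prod.distrib power_mult_distrib)
  also have "\<dots> = 1"
    using assms by (intro prod.neutral) simp
  finally show ?thesis .
qed

text \<open>A real corner frequency cannot cancel the nonzero imaginary part of the evaluation
  point.\<close>

lemma jw_plus_of_real_nonzero: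
  assumes "0 < \<omega>l" and "\<omega>l < \<omega>h"
  shows "jw \<omega>l \<omega>h + of_real x \<noteq> 0"
proof
  assume "jw \<omega>l \<omega>h + of_real x = 0"
  then have "Im (jw \<omega>l \<omega>h + of_real x) = 0" by simp
  with assms show False by (simp add: jw_def)
qed

lemma gain_mult_gain_bar:
  assumes "0 < \<omega>l" and "\<omega>l < \<omega>h"
  shows "gain \<kappa> n k \<omega>l \<omega>h \<epsilon> \<alpha> * gain_bar \<kappa> n k \<omega>l \<omega>h \<epsilon> (1 - \<alpha>) = 1"
proof -
  let ?w = "jw \<omega>l \<omega>h"
  let ?p = "\<lambda>i. cmod (?w + of_real (p_par \<kappa> n k \<omega>l \<omega>h \<epsilon> \<alpha> i))"
  let ?z = "\<lambda>i. cmod (?w + of_real (z_par \<kappa> n k \<omega>l \<omega>h \<epsilon> \<alpha> i))"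
  have "cmod ?w \<noteq> 0"
    using jw_plus_of_real_nonzero[OF assms, of 0] by simp
  then have powers: "cmod ?w powr (- \<alpha>) * cmod ?w powr \<alpha> = 1"
    by (simp flip: powr_add)
  have prods: "(\<Prod>i = 1..n. (?p i / ?z i) ^ k) * (\<Prod>i = 1..n. (?z i / ?p i) ^ k) = 1"
    using jw_plus_of_real_nonzero[OF assms] by (intro prod_power_quotient_inverse) simp_all
  have "gain \<kappa> n k \<omega>l \<omega>h \<epsilon> \<alpha> * gain_bar \<kappa> n k \<omega>l \<omega>h \<epsilon> (1 - \<alpha>)
      = (cmod ?w powr (- \<alpha>) * cmod ?w powr \<alpha>)
        * ((\<Prod>i = 1..n. (?p i / ?z i) ^ k) * (\<Prod>i = 1..n. (?z i / ?p i) ^ k))"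
    by (simp add: gain_def gain_bar_def pbar_par_complement zbar_par_complement norm_divide
        mult_ac)
  with powers prods show ?thesis by simp
qed

lemma rf_var_nonzero: "rf_var \<noteq> 0"
  by (simp add: rf_var_def)

lemma rf_var_plus_rf_const_nonzero: "rf_var + rf_const c \<noteq> 0"
  by (simp add: rf_var_def rf_const_def flip: to_fract_add)

lemma rf_const_mult: "rf_const a * rf_const b = rf_const (a * b)"
  by (simp add: rf_const_def flip: to_fract_mult)

lemma rf_const_1: "rf_const 1 = 1"
  by (simp add: rf_const_def flip: one_pCons)

text \<open>The hypothesis \<open>\<alpha> < 1/2\<close> puts the two orders on different branches of the model;
  at \<open>\<alpha> = 1/2\<close> both would use the lower one and the
  factors would be squared rather than cancel.\<close>

lemma frac_int_mult_complement:
  assumes "0 < \<omega>l" and "\<omega>l < \<omega>h" and "\<alpha> < 1/2"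
  shows "frac_int \<kappa> n k \<omega>l \<omega>h \<epsilon> \<alpha> * frac_int \<kappa> n k \<omega>l \<omega>h \<epsilon> (1 - \<alpha>) = 1 / rf_var"
proof -
  let ?K = "gain \<kappa> n k \<omega>l \<omega>h \<epsilon> \<alpha>"
  let ?L = "gain_bar \<kappa> n k \<omega>l \<omega>h \<epsilon> (1 - \<alpha>)"
  let ?p = "\<lambda>i. rf_var + rf_const (p_par \<kappa> n k \<omega>l \<omega>h \<epsilon> \<alpha> i)"
  let ?z = "\<lambda>i. rf_var + rf_const (z_par \<kappa> n k \<omega>l \<omega>h \<epsilon> \<alpha> i)"
  have lower: "frac_int \<kappa> n k \<omega>l \<omega>h \<epsilon> \<alpha> = rf_const ?K * (\<Prod>i = 1..n. (?z i / ?p i) ^ k)"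
    using assms by (simp add: frac_int_def)
  have upper: "frac_int \<kappa> n k \<omega>l \<omega>h \<epsilon> (1 - \<alpha>)
      = rf_const ?L / rf_var * (\<Prod>i = 1..n. (?p i / ?z i) ^ k)"
    using assms by (simp add: frac_int_def pbar_par_complement zbar_par_complement)
  have gains: "rf_const ?K * rf_const ?L = 1"
    by (simp only: rf_const_mult gain_mult_gain_bar[OF assms(1,2)] rf_const_1)
  have prods: "(\<Prod>i = 1..n. (?z i / ?p i) ^ k) * (\<Prod>i = 1..n. (?p i / ?z i) ^ k) = 1"
    by (intro prod_power_quotient_inverse rf_var_plus_rf_const_nonzero)
  have "frac_int \<kappa> n k \<omega>l \<omega>h \<epsilon> \<alpha> * frac_int \<kappa> n k \<omega>l \<omega>h \<epsilon> (1 - \<alpha>)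
      = (rf_const ?K * rf_const ?L)
        * ((\<Prod>i = 1..n. (?z i / ?p i) ^ k) * (\<Prod>i = 1..n. (?p i / ?z i) ^ k)) / rf_var"
    unfolding lower upper by (simp only: times_divide_eq_left times_divide_eq_right mult_ac)
  then show ?thesis unfolding gains prods by simp
qed

theorem mainTheorem2:
  fixes \<kappa> n k :: nat and \<omega>l \<omega>h \<alpha> \<epsilon> :: real
  assumes "n \<ge> 1" and "k \<ge> 1"
    and "0 < \<omega>l" and "\<omega>l < \<omega>h"
    and "\<kappa> \<in> {1, 2, 3, 4}"
    and "\<alpha> \<in> {0<..<1/2} \<union> {1/2<..<1}"
    and "eps_admissible \<kappa> n k \<omega>l \<omega>h \<alpha> \<epsilon>"
  shows "frac_int \<kappa> n k \<omega>l \<omega>h \<epsilon> \<alpha> * frac_int \<kappa> n k \<omega>l \<omega>h \<epsilon> (1 - \<alpha>) = 1 / rf_var \<and>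
         frac_diff \<kappa> n k \<omega>l \<omega>h \<epsilon> \<alpha> * frac_int \<kappa> n k \<omega>l \<omega>h \<epsilon> \<alpha> = 1 \<and>
         frac_diff \<kappa> n k \<omega>l \<omega>h \<epsilon> \<alpha> * frac_diff \<kappa> n k \<omega>l \<omega>h \<epsilon> (1 - \<alpha>) = rf_var"
proof -
  let ?I = "frac_int \<kappa> n k \<omega>l \<omega>h \<epsilon>"
  have integrators: "?I \<alpha> * ?I (1 - \<alpha>) = 1 / rf_var"
  proof (cases "\<alpha> < 1/2")
    case True
    with assms show ?thesis by (intro frac_int_mult_complement)
  next
    case False
    with assms have "1 - \<alpha> < 1/2" by auto
    with assms have "?I (1 - \<alpha>) * ?I (1 - (1 - \<alpha>)) = 1 / rf_var"
      by (intro frac_int_mult_complement)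
    then show ?thesis by (simp add: mult.commute)
  qed
  then have "?I \<alpha> \<noteq> 0"
    using rf_var_nonzero by auto
  then have inverse: "frac_diff \<kappa> n k \<omega>l \<omega>h \<epsilon> \<alpha> * ?I \<alpha> = 1"
    by (simp add: frac_diff_def)
  have "frac_diff \<kappa> n k \<omega>l \<omega>h \<epsilon> \<alpha> * frac_diff \<kappa> n k \<omega>l \<omega>h \<epsilon> (1 - \<alpha>)
      = 1 / (?I \<alpha> * ?I (1 - \<alpha>))"
    by (simp add: frac_diff_def)
  also have "\<dots> = rf_var"
    by (simp add: integrators)
  finally show ?thesis
    using integrators inverse by blast
qed

end
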